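(* Every consistent set of Horn clauses without free variables has a classical model, and likewise every consistent set of w-Horn clauses without free variables has a classical model.
   Context: **Logic.** MTL is the monoidal t-norm based logic, with algebraic semantics given by MTL-algebras, i.e. bounded integral commutative residuated lattices $(A,\sqcap,\sqcup,*,\Rightarrow,0,1)$ satisfying $(x\Rightarrow y)\sqcup(y\Rightarrow x)=1$; the connectives $\wedge$ (weak conjunction), $\vee$, $\&$ (strong conjunction), $\rightarrow,\overline 0,\overline 1$ are interpreted by $\sqcap,\sqcup,*,\Rightarrow,0,1$. $L$ is a fixed core fuzzy logic (an expansion of MTL with the congruence property for $\leftrightarrow$ and the local deduction theorem: $T,\varphi\vdash\psi$ iff $T\vdash\varphi^n\rightarrow\psi$ for some $n$) whose propositional language contains only the truth-constants $\overline 1$ and $\overline 0$. A predicate language consists of a nonempty set of predicate symbols, a set of function symbols, and arities (0-ary function symbols are individual constants, 0-ary predicate symbols are truth constants). Terms, atomic formulas and formulas are as in classical predicate logic. The predicate logic $L\forall^m$ has as axioms the first-order instances of the axioms of $L$ and ($\forall1$) $(\forall x)\varphi(x)\rightarrow\varphi(t)$, ($\exists1$) $\varphi(t)\rightarrow(\exists x)\varphi(x)$ ($t$ substitutable for $x$ in $\varphi$), ($\forall2$) $(\forall x)(\xi\rightarrow\varphi)\rightarrow(\xi\rightarrow(\forall x)\varphi)$, ($\exists2$) $(\forall x)(\varphi\rightarrow\xi)\rightarrow((\exists x)\varphi\rightarrow\xi)$ ($x$ not free in $\xi$); its rules are those of $L$ and generalization (from $\varphi$ infer $(\forall x)\varphi$).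 Proof and provability are defined analogously to the classical notions; $\Phi\vdash\varphi$ denotes provability in $L\forall^m$ from $\Phi$. $\Phi$ is consistent if $\Phi\not\vdash\overline 0$. **Similarity.** The language has a binary predicate symbol $\approx$ interpreted as a similarity, and the axiomatization of $L\forall^m$ contains the axioms: $(\forall x)\,x\approx x$; $(\forall x)(\forall y)(x\approx y\rightarrow y\approx x)$; $(\forall x)(\forall y)(\forall z)(x\approx y\,\&\,y\approx z\rightarrow x\approx z)$; for each $n$-ary function symbol $F$, the universal closure of $x_1\approx y_1\&\cdots\&x_n\approx y_n\rightarrow F(x_1,\dots,x_n)\approx F(y_1,\dots,y_n)$; for each $n$-ary predicate symbol $P$, the universal closure of $x_1\approx y_1\&\cdots\&x_n\approx y_n\rightarrow(P(x_1,\dots,x_n)\leftrightarrow P(y_1,\dots,y_n))$. **Semantics.** For an algebra $\mathbf A$, an $\mathbf A$-structure $\mathbf M$ has a nonempty domain $M$, a function $P_{\mathbf M}:M^n\to\mathbf A$ for each $n$-ary predicate symbol $P$ (an element of $\mathbf{A}$ if $n=0$), and $F_{\mathbf M}:M^n\to M$ for each $n$-ary function symbol $F$. Truth values $\|\varphi\|^{\mathbf A}_{\mathbf M,v}$ for evaluations $v$ of the variables in $M$ are defined recursively as usual, connectives being interpreted by the operations of $\mathbf A$, $\forall$ by infimum and $\exists$ by supremum over $M$. $\langle\mathbf A,\mathbf M\rangle$ is a model of $\Phi$ if $\|\varphi\|^{\mathbf A}_{\mathbf M,v}=1$ for all $\varphi\in\Phi$ and all evaluations $v$. A classical model is a model $\langle\mathbf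 B,\mathbf M\rangle$ with $\mathbf B$ the two-valued Boolean algebra. **Horn clauses.** A basic Horn formula is a formula $\alpha_1\&\cdots\&\alpha_n\rightarrow\beta$ with $n\in\mathbb N$ and $\alpha_1,\dots,\alpha_n,\beta$ atomic (for $n=0$ it is just the atomic formula $\beta$); a basic w-Horn formula is the same with $\wedge$ in place of $\&$. A quantifier-free Horn formula is $\phi_1\&\cdots\&\phi_m$ with each $\phi_i$ a basic Horn formula; a quantifier-free w-Horn formula is $\phi_1\wedge\cdots\wedge\phi_m$ with each $\phi_i$ a basic w-Horn formula. A (w-)Horn clause is a formula $Q\gamma$ with $Q$ a (possibly empty) string of universal quantifiers and $\gamma$ a quantifier-free (w-)Horn formula. *)

theory Defs
  imports Main
begin

section \<open>Propositional logics expanding MTL\<close>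

text \<open>
  \<open>'c\<close> is the type of names for the connectives that a logic may have in addition to those
  of MTL. \<open>PCon\<close> is strong conjunction, \<open>PAnd\<close> is weak conjunction.
\<close>

datatype 'c pfm =
    PVar nat
  | PBot
  | PTop
  | PCon "'c pfm" "'c pfm"
  | PAnd "'c pfm" "'c pfm"
  | POr "'c pfm" "'c pfm"
  | PImp "'c pfm" "'c pfm"
  | POp 'c "'c pfm list"

abbreviation PIff :: "'c pfm \<Rightarrow> 'c pfm \<Rightarrow> 'c pfm" where
  "PIff a b \<equiv> PCon (PImp a b) (PImp b a)"

fun ppow :: "'c pfm \<Rightarrow> nat \<Rightarrow> 'c pfm" where
  "ppow a 0 = PTop"
| "ppow a (Suc 0) = a"
| "ppow a (Suc (Suc n)) = PCon a (ppow a (Suc n))"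

fun psubst :: "(nat \<Rightarrow> 'c pfm) \<Rightarrow> 'c pfm \<Rightarrow> 'c pfm" where
  "psubst s (PVar i) = s i"
| "psubst s PBot = PBot"
| "psubst s PTop = PTop"
| "psubst s (PCon a b) = PCon (psubst s a) (psubst s b)"
| "psubst s (PAnd a b) = PAnd (psubst s a) (psubst s b)"
| "psubst s (POr a b) = POr (psubst s a) (psubst s b)"
| "psubst s (PImp a b) = PImp (psubst s a) (psubst s b)"
| "psubst s (POp c as) = POp c (map (psubst s) as)"

text \<open>
  A logic is given by its additional connectives with their arities, a set of axioms and a set
  of finitary rules (list of premises, conclusion). Axioms and rules are schematic: their
  propositional variables may be instantiated by arbitrary formulas.
\<close>

record 'c logic =
  conns :: "'c set"
  conn_arity :: "'c \<Rightarrow> nat"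
  axms :: "'c pfm set"
  rls :: "('c pfm list \<times> 'c pfm) set"

fun wf_pfm :: "'c logic \<Rightarrow> 'c pfm \<Rightarrow> bool" where
  "wf_pfm L (PVar i) = True"
| "wf_pfm L PBot = True"
| "wf_pfm L PTop = True"
| "wf_pfm L (PCon a b) = (wf_pfm L a \<and> wf_pfm L b)"
| "wf_pfm L (PAnd a b) = (wf_pfm L a \<and> wf_pfm L b)"
| "wf_pfm L (POr a b) = (wf_pfm L a \<and> wf_pfm L b)"
| "wf_pfm L (PImp a b) = (wf_pfm L a \<and> wf_pfm L b)"
| "wf_pfm L (POp c as) =
     (c \<in> conns L \<and> length as = conn_arity L c \<and> (\<forall>a\<in>set as. wf_pfm L a))"

definition wf_logic :: "'c logic \<Rightarrow> bool" where
  "wf_logic L \<longleftrightarrow> (\<forall>a\<in>axms L. wf_pfm L a) \<and>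
     (\<forall>(ps, c)\<in>rls L. wf_pfm L c \<and> (\<forall>p\<in>set ps. wf_pfm L p))"

inductive pprov :: "'c logic \<Rightarrow> 'c pfm set \<Rightarrow> 'c pfm \<Rightarrow> bool" for L T where
  Hyp: "a \<in> T \<Longrightarrow> wf_pfm L a \<Longrightarrow> pprov L T a"
| Ax: "a \<in> axms L \<Longrightarrow> (\<And>i. wf_pfm L (s i)) \<Longrightarrow> pprov L T (psubst s a)"
| Rule: "(ps, c) \<in> rls L \<Longrightarrow> (\<And>i. wf_pfm L (s i)) \<Longrightarrow>
    (\<And>p. p \<in> set ps \<Longrightarrow> pprov L T (psubst s p)) \<Longrightarrow> pprov L T (psubst s c)"

text \<open>
  The axioms are those of Esteva and Godo, who take strong conjunction, weak conjunction,
  implication and falsum as primitive; the last four state their definitions of disjunction and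
  verum, which are primitive here.
\<close>

definition mtl_axms :: "'c pfm set" where
  "mtl_axms = (let p = PVar 0; q = PVar 1; r = PVar 2;
      d = PAnd (PImp (PImp p q) q) (PImp (PImp q p) p) in
    {PImp (PImp p q) (PImp (PImp q r) (PImp p r)),
     PImp (PCon p q) p,
     PImp (PCon p q) (PCon q p),
     PImp (PAnd p q) p,
     PImp (PAnd p q) (PAnd q p),
     PImp (PCon p (PImp p q)) (PAnd p q),
     PImp (PImp p (PImp q r)) (PImp (PCon p q) r),
     PImp (PImp (PCon p q) r) (PImp p (PImp q r)),
     PImp (PImp (PImp p q) r) (PImp (PImp (PImp q p) r) r),
     PImp PBot p,
     PImp (POr p q) d,
     PImp d (POr p q),
     PImp PTop (PImp PBot PBot),
     PImp (PImp PBot PBot) PTop})"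

definition MTL :: "'c logic" where
  "MTL = \<lparr>conns = {}, conn_arity = (\<lambda>_. 0), axms = mtl_axms,
     rls = {([PVar 0, PImp (PVar 0) (PVar 1)], PVar 1)}\<rparr>"

definition core_fuzzy_logic :: "'c logic \<Rightarrow> bool" where
  "core_fuzzy_logic L \<longleftrightarrow> wf_logic L \<and>
     (\<forall>T a. pprov MTL T a \<longrightarrow> pprov L T a) \<and>
     (\<forall>a b x i. wf_pfm L a \<longrightarrow> wf_pfm L b \<longrightarrow> wf_pfm L x \<longrightarrow>
        pprov L {PIff a b}
          (PIff (psubst (PVar(i := a)) x) (psubst (PVar(i := b)) x))) \<and>
     (\<forall>T a b. (\<forall>t\<in>T. wf_pfm L t) \<longrightarrow> wf_pfm L a \<longrightarrow> wf_pfm L b \<longrightarrow>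
        (pprov L (insert a T) b \<longleftrightarrow> (\<exists>n. pprov L T (PImp (ppow a n) b))))"

definition only_standard_truth_constants :: "'c logic \<Rightarrow> bool" where
  "only_standard_truth_constants L \<longleftrightarrow> (\<forall>c\<in>conns L. 0 < conn_arity L c)"


section \<open>Predicate languages\<close>

datatype 'f tm = Var nat | Fn 'f "'f tm list"

datatype ('c, 'f, 'p) fm =
    Atom 'p "'f tm list"
  | Bot
  | Top
  | Con "('c, 'f, 'p) fm" "('c, 'f, 'p) fm"
  | And "('c, 'f, 'p) fm" "('c, 'f, 'p) fm"
  | Or "('c, 'f, 'p) fm" "('c, 'f, 'p) fm"
  | Imp "('c, 'f, 'p) fm" "('c, 'f, 'p) fm"
  | Op 'c "('c, 'f, 'p) fm list"
  | Forall nat "('c, 'f, 'p) fm"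
  | Exists nat "('c, 'f, 'p) fm"

abbreviation Iff :: "('c, 'f, 'p) fm \<Rightarrow> ('c, 'f, 'p) fm \<Rightarrow> ('c, 'f, 'p) fm" where
  "Iff a b \<equiv> Con (Imp a b) (Imp b a)"

record ('f, 'p) language =
  preds :: "'p set"
  pred_arity :: "'p \<Rightarrow> nat"
  funs :: "'f set"
  fun_arity :: "'f \<Rightarrow> nat"
  sim :: 'p

text \<open>Nonemptiness of the set of predicate symbols follows from the presence of \<open>sim\<close>.\<close>

definition wf_language :: "('f, 'p) language \<Rightarrow> bool" where
  "wf_language S \<longleftrightarrow> sim S \<in> preds S \<and> pred_arity S (sim S) = 2"

fun wf_tm :: "('f, 'p) language \<Rightarrow> 'f tm \<Rightarrow> bool" where
  "wf_tm S (Var x) = True"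
| "wf_tm S (Fn f ts) =
     (f \<in> funs S \<and> length ts = fun_arity S f \<and> (\<forall>t\<in>set ts. wf_tm S t))"

fun wf_fm :: "'c logic \<Rightarrow> ('f, 'p) language \<Rightarrow> ('c, 'f, 'p) fm \<Rightarrow> bool" where
  "wf_fm L S (Atom p ts) =
     (p \<in> preds S \<and> length ts = pred_arity S p \<and> (\<forall>t\<in>set ts. wf_tm S t))"
| "wf_fm L S Bot = True"
| "wf_fm L S Top = True"
| "wf_fm L S (Con a b) = (wf_fm L S a \<and> wf_fm L S b)"
| "wf_fm L S (And a b) = (wf_fm L S a \<and> wf_fm L S b)"
| "wf_fm L S (Or a b) = (wf_fm L S a \<and> wf_fm L S b)"
| "wf_fm L S (Imp a b) = (wf_fm L S a \<and> wf_fm L S b)"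
| "wf_fm L S (Op c as) =
     (c \<in> conns L \<and> length as = conn_arity L c \<and> (\<forall>a\<in>set as. wf_fm L S a))"
| "wf_fm L S (Forall x a) = wf_fm L S a"
| "wf_fm L S (Exists x a) = wf_fm L S a"

fun fvt :: "'f tm \<Rightarrow> nat set" where
  "fvt (Var x) = {x}"
| "fvt (Fn f ts) = (\<Union>t\<in>set ts. fvt t)"

fun fv :: "('c, 'f, 'p) fm \<Rightarrow> nat set" where
  "fv (Atom p ts) = (\<Union>t\<in>set ts. fvt t)"
| "fv Bot = {}"
| "fv Top = {}"
| "fv (Con a b) = fv a \<union> fv b"
| "fv (And a b) = fv a \<union> fv b"
| "fv (Or a b) = fv a \<union> fv b"
| "fv (Imp a b) = fv a \<union> fv b"
| "fv (Op c as) = (\<Union>a\<in>set as. fv a)"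
| "fv (Forall x a) = fv a - {x}"
| "fv (Exists x a) = fv a - {x}"

fun tsubst :: "nat \<Rightarrow> 'f tm \<Rightarrow> 'f tm \<Rightarrow> 'f tm" where
  "tsubst x t (Var y) = (if y = x then t else Var y)"
| "tsubst x t (Fn f ts) = Fn f (map (tsubst x t) ts)"

text \<open>Substitution for free occurrences, without renaming of bound variables.\<close>

fun subst :: "nat \<Rightarrow> 'f tm \<Rightarrow> ('c, 'f, 'p) fm \<Rightarrow> ('c, 'f, 'p) fm" where
  "subst x t (Atom p ts) = Atom p (map (tsubst x t) ts)"
| "subst x t Bot = Bot"
| "subst x t Top = Top"
| "subst x t (Con a b) = Con (subst x t a) (subst x t b)"
| "subst x t (And a b) = And (subst x t a) (subst x t b)"
| "subst x t (Or a b) = Or (subst x t a) (subst x t b)"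
| "subst x t (Imp a b) = Imp (subst x t a) (subst x t b)"
| "subst x t (Op c as) = Op c (map (subst x t) as)"
| "subst x t (Forall y a) = Forall y (if y = x then a else subst x t a)"
| "subst x t (Exists y a) = Exists y (if y = x then a else subst x t a)"

fun substitutable :: "'f tm \<Rightarrow> nat \<Rightarrow> ('c, 'f, 'p) fm \<Rightarrow> bool" where
  "substitutable t x (Atom p ts) = True"
| "substitutable t x Bot = True"
| "substitutable t x Top = True"
| "substitutable t x (Con a b) = (substitutable t x a \<and> substitutable t x b)"
| "substitutable t x (And a b) = (substitutable t x a \<and> substitutable t x b)"
| "substitutable t x (Or a b) = (substitutable t x a \<and> substitutable t x b)"
| "substitutable t x (Imp a b) = (substitutable t x a \<and> substitutable t x b)"
| "substitutable t x (Op c as) = (\<forall>a\<in>set as. substitutable t x a)"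
| "substitutable t x (Forall y a) =
     (x \<notin> fv (Forall y a) \<or> (y \<notin> fvt t \<and> substitutable t x a))"
| "substitutable t x (Exists y a) =
     (x \<notin> fv (Exists y a) \<or> (y \<notin> fvt t \<and> substitutable t x a))"


section \<open>Provability in the predicate logic\<close>

fun inst :: "(nat \<Rightarrow> ('c, 'f, 'p) fm) \<Rightarrow> 'c pfm \<Rightarrow> ('c, 'f, 'p) fm" where
  "inst s (PVar i) = s i"
| "inst s PBot = Bot"
| "inst s PTop = Top"
| "inst s (PCon a b) = Con (inst s a) (inst s b)"
| "inst s (PAnd a b) = And (inst s a) (inst s b)"
| "inst s (POr a b) = Or (inst s a) (inst s b)"
| "inst s (PImp a b) = Imp (inst s a) (inst s b)"
| "inst s (POp c as) = Op c (map (inst s) as)"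

text \<open>
  \<open>imp_from [a1, \<dots>, an] b\<close> is the implication from the strong conjunction of \<open>a1, \<dots>, an\<close>
  to \<open>b\<close>, which is just \<open>b\<close> if \<open>n = 0\<close>.
\<close>

fun sconj :: "('c, 'f, 'p) fm list \<Rightarrow> ('c, 'f, 'p) fm" where
  "sconj [] = Top"
| "sconj [a] = a"
| "sconj (a # b # as) = Con a (sconj (b # as))"

fun imp_from :: "('c, 'f, 'p) fm list \<Rightarrow> ('c, 'f, 'p) fm \<Rightarrow> ('c, 'f, 'p) fm" where
  "imp_from [] b = b"
| "imp_from (a # as) b = Imp (sconj (a # as)) b"

abbreviation foralls :: "nat list \<Rightarrow> ('c, 'f, 'p) fm \<Rightarrow> ('c, 'f, 'p) fm" where
  "foralls xs a \<equiv> foldr Forall xs a"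

definition sim_atom :: "('f, 'p) language \<Rightarrow> 'f tm \<Rightarrow> 'f tm \<Rightarrow> ('c, 'f, 'p) fm" where
  "sim_atom S s t = Atom (sim S) [s, t]"

text \<open>
  In the congruence axioms for an \<open>n\<close>-ary symbol the variables \<open>0, \<dots>, n - 1\<close> and
  \<open>n, \<dots>, 2 * n - 1\<close> play the roles of \<open>x1, \<dots>, xn\<close> and \<open>y1, \<dots>, yn\<close>.
\<close>

definition congruence_axm ::
  "('f, 'p) language \<Rightarrow> nat \<Rightarrow> ('f tm list \<Rightarrow> 'f tm list \<Rightarrow> ('c, 'f, 'p) fm) \<Rightarrow> ('c, 'f, 'p) fm"
where
  "congruence_axm S n concl =
     foralls [0..<2 * n]
       (imp_from (map (\<lambda>i. sim_atom S (Var i) (Var (n + i))) [0..<n])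
         (concl (map Var [0..<n]) (map Var [n..<2 * n])))"

definition sim_axms :: "('f, 'p) language \<Rightarrow> ('c, 'f, 'p) fm set" where
  "sim_axms S =
     {foralls [0] (sim_atom S (Var 0) (Var 0)),
      foralls [0, 1] (Imp (sim_atom S (Var 0) (Var 1)) (sim_atom S (Var 1) (Var 0))),
      foralls [0, 1, 2]
        (Imp (Con (sim_atom S (Var 0) (Var 1)) (sim_atom S (Var 1) (Var 2)))
          (sim_atom S (Var 0) (Var 2)))} \<union>
     {congruence_axm S (fun_arity S f) (\<lambda>xs ys. sim_atom S (Fn f xs) (Fn f ys)) | f. f \<in> funs S} \<union>
     {congruence_axm S (pred_arity S p) (\<lambda>xs ys. Iff (Atom p xs) (Atom p ys)) | p. p \<in> preds S}"

inductive prov ::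
  "'c logic \<Rightarrow> ('f, 'p) language \<Rightarrow> ('c, 'f, 'p) fm set \<Rightarrow> ('c, 'f, 'p) fm \<Rightarrow> bool"
  for L S \<Phi>
where
  Hyp: "a \<in> \<Phi> \<Longrightarrow> wf_fm L S a \<Longrightarrow> prov L S \<Phi> a"
| Ax: "a \<in> axms L \<Longrightarrow> (\<And>i. wf_fm L S (s i)) \<Longrightarrow> prov L S \<Phi> (inst s a)"
| Forall1: "wf_fm L S a \<Longrightarrow> wf_tm S t \<Longrightarrow> substitutable t x a \<Longrightarrow>
    prov L S \<Phi> (Imp (Forall x a) (subst x t a))"
| Exists1: "wf_fm L S a \<Longrightarrow> wf_tm S t \<Longrightarrow> substitutable t x a \<Longrightarrow>
    prov L S \<Phi> (Imp (subst x t a) (Exists x a))"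
| Forall2: "wf_fm L S a \<Longrightarrow> wf_fm L S b \<Longrightarrow> x \<notin> fv b \<Longrightarrow>
    prov L S \<Phi> (Imp (Forall x (Imp b a)) (Imp b (Forall x a)))"
| Exists2: "wf_fm L S a \<Longrightarrow> wf_fm L S b \<Longrightarrow> x \<notin> fv b \<Longrightarrow>
    prov L S \<Phi> (Imp (Forall x (Imp a b)) (Imp (Exists x a) b))"
| Sim: "a \<in> sim_axms S \<Longrightarrow> prov L S \<Phi> a"
| Rule: "(ps, c) \<in> rls L \<Longrightarrow> (\<And>i. wf_fm L S (s i)) \<Longrightarrow>
    (\<And>p. p \<in> set ps \<Longrightarrow> prov L S \<Phi> (inst s p)) \<Longrightarrow> prov L S \<Phi> (inst s c)"
| Gen: "prov L S \<Phi> a \<Longrightarrow> prov L S \<Phi> (Forall x a)"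

definition consistent :: "'c logic \<Rightarrow> ('f, 'p) language \<Rightarrow> ('c, 'f, 'p) fm set \<Rightarrow> bool" where
  "consistent L S \<Phi> \<longleftrightarrow> \<not> prov L S \<Phi> Bot"


section \<open>Semantics\<close>

text \<open>The carrier of an algebra is the whole type \<open>'a\<close>; its order is the one of \<open>meet\<close>.\<close>

record ('c, 'a) algebra =
  meet :: "'a \<Rightarrow> 'a \<Rightarrow> 'a"
  join :: "'a \<Rightarrow> 'a \<Rightarrow> 'a"
  mult :: "'a \<Rightarrow> 'a \<Rightarrow> 'a"
  residuum :: "'a \<Rightarrow> 'a \<Rightarrow> 'a"
  zero :: 'a
  one :: 'a
  conn_op :: "'c \<Rightarrow> 'a list \<Rightarrow> 'a"

definition leq :: "('c, 'a) algebra \<Rightarrow> 'a \<Rightarrow> 'a \<Rightarrow> bool" where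
  "leq A x y \<longleftrightarrow> meet A x y = x"

definition infimum :: "('c, 'a) algebra \<Rightarrow> 'a set \<Rightarrow> 'a" where
  "infimum A X = (THE z. (\<forall>x\<in>X. leq A z x) \<and> (\<forall>y. (\<forall>x\<in>X. leq A y x) \<longrightarrow> leq A y z))"

definition supremum :: "('c, 'a) algebra \<Rightarrow> 'a set \<Rightarrow> 'a" where
  "supremum A X = (THE z. (\<forall>x\<in>X. leq A x z) \<and> (\<forall>y. (\<forall>x\<in>X. leq A x y) \<longrightarrow> leq A z y))"

record ('m, 'f, 'p, 'a) struct =
  dom :: "'m set"
  pred_int :: "'p \<Rightarrow> 'm list \<Rightarrow> 'a"
  fun_int :: "'f \<Rightarrow> 'm list \<Rightarrow> 'm"

definition wf_struct :: "('f, 'p) language \<Rightarrow> ('m, 'f, 'p, 'a) struct \<Rightarrow> bool" where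
  "wf_struct S M \<longleftrightarrow> dom M \<noteq> {} \<and>
     (\<forall>f\<in>funs S. \<forall>ms. set ms \<subseteq> dom M \<longrightarrow> length ms = fun_arity S f \<longrightarrow> fun_int M f ms \<in> dom M)"

fun tval :: "('m, 'f, 'p, 'a) struct \<Rightarrow> (nat \<Rightarrow> 'm) \<Rightarrow> 'f tm \<Rightarrow> 'm" where
  "tval M v (Var x) = v x"
| "tval M v (Fn f ts) = fun_int M f (map (tval M v) ts)"

fun val ::
  "('c, 'a) algebra \<Rightarrow> ('m, 'f, 'p, 'a) struct \<Rightarrow> (nat \<Rightarrow> 'm) \<Rightarrow> ('c, 'f, 'p) fm \<Rightarrow> 'a"
where
  "val A M v (Atom p ts) = pred_int M p (map (tval M v) ts)"
| "val A M v Bot = zero A"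
| "val A M v Top = one A"
| "val A M v (Con a b) = mult A (val A M v a) (val A M v b)"
| "val A M v (And a b) = meet A (val A M v a) (val A M v b)"
| "val A M v (Or a b) = join A (val A M v a) (val A M v b)"
| "val A M v (Imp a b) = residuum A (val A M v a) (val A M v b)"
| "val A M v (Op c as) = conn_op A c (map (val A M v) as)"
| "val A M v (Forall x a) = infimum A ((\<lambda>m. val A M (v(x := m)) a) ` dom M)"
| "val A M v (Exists x a) = supremum A ((\<lambda>m. val A M (v(x := m)) a) ` dom M)"

text \<open>Validity of \<open>sim_axms\<close> expresses that the symbol \<open>sim\<close> is interpreted as a similarity.\<close>

definition model ::
  "('f, 'p) language \<Rightarrow> ('c, 'a) algebra \<Rightarrow> ('m, 'f, 'p, 'a) struct \<Rightarrow> ('c, 'f, 'p) fm set \<Rightarrow> bool"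
where
  "model S A M \<Phi> \<longleftrightarrow> wf_struct S M \<and>
     (\<forall>a\<in>sim_axms S \<union> \<Phi>. \<forall>v. range v \<subseteq> dom M \<longrightarrow> val A M v a = one A)"

definition boolean_algebra2 :: "('c \<Rightarrow> bool list \<Rightarrow> bool) \<Rightarrow> ('c, bool) algebra" where
  "boolean_algebra2 I = \<lparr>meet = (\<and>), join = (\<or>), mult = (\<and>), residuum = (\<longrightarrow>),
     zero = False, one = True, conn_op = I\<rparr>"

text \<open>
  The two-valued Boolean algebra does not determine the meaning of the additional connectives
  of a logic (and need not be the reduct of any of its algebras), so a classical model has to
  be one under every interpretation of them. Horn clauses contain none of them.
\<close>

definition classical_model ::
  "('f, 'p) language \<Rightarrow> ('m, 'f, 'p, bool) struct \<Rightarrow> ('c, 'f, 'p) fm set \<Rightarrow> bool"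
where
  "classical_model S M \<Phi> \<longleftrightarrow> (\<forall>I. model S (boolean_algebra2 I) M \<Phi>)"


section \<open>Horn clauses\<close>

text \<open>
  The truth constants count as atomic formulas. In particular clauses with head \<open>Bot\<close> are
  allowed; without them every set of clauses would be consistent over a consistent logic.
\<close>

definition atomic :: "('c, 'f, 'p) fm \<Rightarrow> bool" where
  "atomic a \<longleftrightarrow> a = Bot \<or> a = Top \<or> (\<exists>p ts. a = Atom p ts)"

text \<open>
  \<open>conj_of cj P\<close> holds of the formulas \<open>a1 cj \<dots> cj an\<close> with \<open>n \<ge> 1\<close>, under any bracketing,
  whose members \<open>ai\<close> satisfy \<open>P\<close>.
\<close>

inductive conj_of ::
  "(('c, 'f, 'p) fm \<Rightarrow> ('c, 'f, 'p) fm \<Rightarrow> ('c, 'f, 'p) fm) \<Rightarrow> (('c, 'f, 'p) fm \<Rightarrow> bool) \<Rightarrow>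
    ('c, 'f, 'p) fm \<Rightarrow> bool"
  for cj P
where
  Base: "P a \<Longrightarrow> conj_of cj P a"
| Step: "conj_of cj P a \<Longrightarrow> conj_of cj P b \<Longrightarrow> conj_of cj P (cj a b)"

definition basic_horn ::
  "(('c, 'f, 'p) fm \<Rightarrow> ('c, 'f, 'p) fm \<Rightarrow> ('c, 'f, 'p) fm) \<Rightarrow> ('c, 'f, 'p) fm \<Rightarrow> bool"
where
  "basic_horn cj a \<longleftrightarrow> atomic a \<or> (\<exists>b c. a = Imp b c \<and> conj_of cj atomic b \<and> atomic c)"

definition horn_clause_with ::
  "(('c, 'f, 'p) fm \<Rightarrow> ('c, 'f, 'p) fm \<Rightarrow> ('c, 'f, 'p) fm) \<Rightarrow> ('c, 'f, 'p) fm \<Rightarrow> bool"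
where
  "horn_clause_with cj a \<longleftrightarrow> (\<exists>xs b. a = foralls xs b \<and> conj_of cj (basic_horn cj) b)"

definition horn_clause :: "('c, 'f, 'p) fm \<Rightarrow> bool" where
  "horn_clause = horn_clause_with Con"

definition w_horn_clause :: "('c, 'f, 'p) fm \<Rightarrow> bool" where
  "w_horn_clause = horn_clause_with And"

end

(* A consistent set of (w-)Horn clauses holds in the classical term structure in which an atomic
   formula is true iff it is provable. MTL proves enough about both conjunctions for provability
   to commute with the antecedents of Horn clauses, and consistency takes care of the falsum.
   The domain consists of the terms without variables other than 0: it is nonempty even if the
   language has no constants, and evaluations in it, read as simultaneous substitutions, can be
   carried out one variable at a time without renaming. *)

theory Submission
  imports Defs
begin

section \<open>Transfer of propositional derivations\<close>

lemma psubst_in_inst: "inst s (psubst r a) = inst (\<lambda>i. inst s (r i)) a"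
  by (induction a) auto

lemma wf_fm_inst: "wf_pfm L a \<Longrightarrow> (\<And>i. wf_fm L S (s i)) \<Longrightarrow> wf_fm L S (inst s a)"
  by (induction a) auto

text \<open>Instances compose (\<open>psubst_in_inst\<close>), so each axiom or rule step of the
  propositional derivation becomes a step of the same kind in the predicate logic.\<close>

lemma prov_inst:
  assumes "pprov L T a" and s: "\<And>i. wf_fm L S (s i)"
    and T: "\<And>t. t \<in> T \<Longrightarrow> prov L S \<Phi> (inst s t)"
  shows "prov L S \<Phi> (inst s a)"
  using assms(1)
proof (induction rule: pprov.induct)
  case (Hyp a)
  then show ?case by (simp add: T)
next
  case (Ax a r)
  then show ?case
    by (simp add: psubst_in_inst prov.Ax s wf_fm_inst)
next
  case (Rule ps c r)
  have "prov L S \<Phi> (inst (\<lambda>i. inst s (r i)) c)"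
    by (rule prov.Rule[OF Rule(1)]) (use Rule s in \<open>auto simp: psubst_in_inst wf_fm_inst\<close>)
  then show ?case by (simp add: psubst_in_inst)
qed

section \<open>Derivations in MTL\<close>

lemma MTL_mp:
  assumes "pprov MTL T a" "pprov MTL T (PImp a b)" "wf_pfm MTL a" "wf_pfm MTL b"
  shows "pprov MTL T b"
proof -
  let ?s = "\<lambda>i. if i = 0 then a else b"
  have "pprov MTL T (psubst ?s (PVar 1))"
    by (rule pprov.Rule[where ps = "[PVar 0, PImp (PVar 0) (PVar 1)]"])
      (use assms in \<open>auto simp: MTL_def\<close>)
  then show ?thesis by simp
qed

text \<open>One substitution serves all schemas; where a schema lacks \<open>c\<close>, later uses
  fill it with \<open>PBot\<close>.\<close>

lemma MTL_axm:
  assumes "wf_pfm MTL a" "wf_pfm MTL b" "wf_pfm MTL c"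
  shows "pprov MTL T (PImp (PImp a b) (PImp (PImp b c) (PImp a c)))"
    and "pprov MTL T (PImp (PCon a b) a)"
    and "pprov MTL T (PImp (PCon a b) (PCon b a))"
    and "pprov MTL T (PImp (PAnd a b) a)"
    and "pprov MTL T (PImp (PAnd a b) (PAnd b a))"
    and "pprov MTL T (PImp (PCon a (PImp a b)) (PAnd a b))"
    and "pprov MTL T (PImp (PImp (PCon a b) c) (PImp a (PImp b c)))"
    and "pprov MTL T (PImp PBot a)"
    and "pprov MTL T (PImp (PImp PBot PBot) PTop)"
proof -
  let ?s = "\<lambda>i. if i = 0 then a else if i = 1 then b else c"
  have ax: "pprov MTL T (psubst ?s x)" if "x \<in> mtl_axms" for x
    by (rule pprov.Ax) (use that assms in \<open>auto simp: MTL_def\<close>)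
  let ?p = "PVar 0" and ?q = "PVar 1" and ?r = "PVar 2"
  show "pprov MTL T (PImp (PImp a b) (PImp (PImp b c) (PImp a c)))"
    using ax[of "PImp (PImp ?p ?q) (PImp (PImp ?q ?r) (PImp ?p ?r))"]
    by (simp add: mtl_axms_def Let_def)
  show "pprov MTL T (PImp (PCon a b) a)"
    using ax[of "PImp (PCon ?p ?q) ?p"] by (simp add: mtl_axms_def Let_def)
  show "pprov MTL T (PImp (PCon a b) (PCon b a))"
    using ax[of "PImp (PCon ?p ?q) (PCon ?q ?p)"] by (simp add: mtl_axms_def Let_def)
  show "pprov MTL T (PImp (PAnd a b) a)"
    using ax[of "PImp (PAnd ?p ?q) ?p"] by (simp add: mtl_axms_def Let_def)
  show "pprov MTL T (PImp (PAnd a b) (PAnd b a))"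
    using ax[of "PImp (PAnd ?p ?q) (PAnd ?q ?p)"] by (simp add: mtl_axms_def Let_def)
  show "pprov MTL T (PImp (PCon a (PImp a b)) (PAnd a b))"
    using ax[of "PImp (PCon ?p (PImp ?p ?q)) (PAnd ?p ?q)"] by (simp add: mtl_axms_def Let_def)
  show "pprov MTL T (PImp (PImp (PCon a b) c) (PImp a (PImp b c)))"
    using ax[of "PImp (PImp (PCon ?p ?q) ?r) (PImp ?p (PImp ?q ?r))"]
    by (simp add: mtl_axms_def Let_def)
  show "pprov MTL T (PImp PBot a)"
    using ax[of "PImp PBot ?p"] by (simp add: mtl_axms_def Let_def)
  show "pprov MTL T (PImp (PImp PBot PBot) PTop)"
    using ax[of "PImp (PImp PBot PBot) PTop"] by (simp add: mtl_axms_def Let_def)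
qed

lemma MTL_trans:
  assumes "pprov MTL T (PImp a b)" "pprov MTL T (PImp b c)"
    "wf_pfm MTL a" "wf_pfm MTL b" "wf_pfm MTL c"
  shows "pprov MTL T (PImp a c)"
proof -
  have "pprov MTL T (PImp (PImp b c) (PImp a c))"
    by (rule MTL_mp[OF assms(1) MTL_axm(1)]) (use assms in auto)
  from MTL_mp[OF assms(2) this] show ?thesis using assms by auto
qed

lemma MTL_curry:
  assumes "pprov MTL T (PImp (PCon a b) c)" "wf_pfm MTL a" "wf_pfm MTL b" "wf_pfm MTL c"
  shows "pprov MTL T (PImp a (PImp b c))"
  by (rule MTL_mp[OF assms(1) MTL_axm(7)]) (use assms in auto)

text \<open>The projection \<open>PImp (PCon b a) b\<close> residuates to
  \<open>PImp b (PImp a b)\<close>, from which \<open>b\<close> is detached.\<close>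

lemma MTL_weaken:
  assumes "pprov MTL T b" "wf_pfm MTL a" "wf_pfm MTL b"
  shows "pprov MTL T (PImp a b)"
  using MTL_mp[OF assms(1) MTL_curry[OF MTL_axm(2)[where c = PBot]]] assms by simp

lemma MTL_Top: "pprov MTL T PTop"
  using MTL_mp[OF MTL_axm(8)[of PBot PBot PBot] MTL_axm(9)[of PBot PBot PBot]] by simp

text \<open>Identity is not among the axioms. Commuting and projecting give
  \<open>PImp (PCon PTop a) a\<close>; residuation and detaching \<open>PTop\<close> finish.\<close>

lemma MTL_refl:
  assumes "wf_pfm MTL a"
  shows "pprov MTL T (PImp a a)"
proof -
  have "pprov MTL T (PImp (PCon PTop a) a)"
    by (rule MTL_trans[OF MTL_axm(3)[where c = PBot] MTL_axm(2)[where c = PBot]])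
      (use assms in auto)
  then have "pprov MTL T (PImp PTop (PImp a a))" by (rule MTL_curry) (use assms in auto)
  with MTL_Top show ?thesis using MTL_mp assms by force
qed

lemma MTL_ConI:
  assumes "pprov MTL T a" "pprov MTL T b" "wf_pfm MTL a" "wf_pfm MTL b"
  shows "pprov MTL T (PCon a b)"
proof -
  have "pprov MTL T (PImp a (PImp b (PCon a b)))"
    by (rule MTL_curry[OF MTL_refl]) (use assms in auto)
  then have "pprov MTL T (PImp b (PCon a b))"
    using MTL_mp[OF assms(1)] assms by simp
  then show ?thesis using MTL_mp[OF assms(2)] assms by simp
qed

text \<open>Residuation concerns strong conjunction only, so the way leads through
  \<open>PCon a (PImp a b)\<close>, which implies \<open>PAnd a b\<close>.\<close>

lemma MTL_AndI:
  assumes "pprov MTL T a" "pprov MTL T b" "wf_pfm MTL a" "wf_pfm MTL b"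
  shows "pprov MTL T (PAnd a b)"
proof -
  have "pprov MTL T (PCon a (PImp a b))"
    using MTL_ConI[OF assms(1) MTL_weaken[OF assms(2)]] assms by simp
  then show ?thesis using MTL_mp MTL_axm(6)[where c = PBot] assms by force
qed

section \<open>Propositional reasoning in the predicate logic\<close>

text \<open>A core fuzzy logic inherits from MTL also derivations from hypotheses;
  \<open>prov_inst\<close> carries them over to predicate formulas.\<close>

lemma prov_MTL_binary:
  assumes "core_fuzzy_logic L" "wf_fm L S a" "wf_fm L S b" "pprov MTL T x"
    and "\<forall>t\<in>T. prov L S \<Phi> (inst (\<lambda>i. if i = 0 then a else b) t)"
  shows "prov L S \<Phi> (inst (\<lambda>i. if i = 0 then a else b) x)"
proof (rule prov_inst)
  show "pprov L T x" using assms(1,4) by (simp only: core_fuzzy_logic_def)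
qed (use assms(2,3,5) in simp_all)

text \<open>Detachment need not be a rule of \<open>L\<close>; it is inherited as an MTL derivation
  from two hypotheses.\<close>

lemma prov_mp:
  assumes "core_fuzzy_logic L" "wf_fm L S a" "wf_fm L S b"
    and "prov L S \<Phi> a" "prov L S \<Phi> (Imp a b)"
  shows "prov L S \<Phi> b"
proof -
  let ?T = "{PVar 0, PImp (PVar 0) (PVar 1)}"
  have "pprov MTL ?T (PVar 1)"
    by (rule MTL_mp[of _ "PVar 0"]) (auto intro: pprov.Hyp)
  from prov_MTL_binary[OF assms(1-3) this, of \<Phi>] assms(4,5) show ?thesis by auto
qed

lemma prov_Top:
  assumes "core_fuzzy_logic L"
  shows "prov L S \<Phi> Top"
  using prov_MTL_binary[OF assms, of S Bot Bot "{}" PTop \<Phi>] MTL_Top by auto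

text \<open>The second projection comes from commutativity. As far as provability goes both
  conjunctions are classical, which is why the two kinds of clauses can be treated alike.\<close>

lemma prov_Con_iff:
  assumes "core_fuzzy_logic L" "wf_fm L S a" "wf_fm L S b"
  shows "prov L S \<Phi> (Con a b) \<longleftrightarrow> prov L S \<Phi> a \<and> prov L S \<Phi> b"
proof -
  let ?p = "PVar 0" and ?q = "PVar 1" and ?pq = "PCon (PVar 0) (PVar 1)"
  have "pprov MTL {?pq} ?pq" "pprov MTL {?p, ?q} ?p" "pprov MTL {?p, ?q} ?q"
    by (auto intro: pprov.Hyp)
  moreover from this(1) have "pprov MTL {?pq} (PCon ?q ?p)"
    by (rule MTL_mp[OF _ MTL_axm(3)[where c = PBot]]) auto
  ultimately have "pprov MTL {?pq} ?p" "pprov MTL {?pq} ?q" "pprov MTL {?p, ?q} ?pq"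
    by (auto intro: MTL_ConI MTL_mp[OF _ MTL_axm(2)[where c = PBot]])
  note this[THEN prov_MTL_binary[OF assms, where \<Phi> = \<Phi>]]
  from this[simplified] show ?thesis by blast
qed

lemma prov_And_iff:
  assumes "core_fuzzy_logic L" "wf_fm L S a" "wf_fm L S b"
  shows "prov L S \<Phi> (And a b) \<longleftrightarrow> prov L S \<Phi> a \<and> prov L S \<Phi> b"
proof -
  let ?p = "PVar 0" and ?q = "PVar 1" and ?pq = "PAnd (PVar 0) (PVar 1)"
  have "pprov MTL {?pq} ?pq" "pprov MTL {?p, ?q} ?p" "pprov MTL {?p, ?q} ?q"
    by (auto intro: pprov.Hyp)
  moreover from this(1) have "pprov MTL {?pq} (PAnd ?q ?p)"
    by (rule MTL_mp[OF _ MTL_axm(5)[where c = PBot]]) auto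
  ultimately have "pprov MTL {?pq} ?p" "pprov MTL {?pq} ?q" "pprov MTL {?p, ?q} ?pq"
    by (auto intro: MTL_AndI MTL_mp[OF _ MTL_axm(4)[where c = PBot]])
  note this[THEN prov_MTL_binary[OF assms, where \<Phi> = \<Phi>]]
  from this[simplified] show ?thesis by blast
qed

section \<open>Simultaneous substitution\<close>

fun tsubsts :: "(nat \<Rightarrow> 'f tm) \<Rightarrow> 'f tm \<Rightarrow> 'f tm" where
  "tsubsts r (Var x) = r x"
| "tsubsts r (Fn f ts) = Fn f (map (tsubsts r) ts)"

text \<open>Bound variables are not renamed, so terms may be captured; results on composing
  substitutions or preserving provability therefore assume \<open>qfree\<close>.\<close>

fun substs :: "(nat \<Rightarrow> 'f tm) \<Rightarrow> ('c, 'f, 'p) fm \<Rightarrow> ('c, 'f, 'p) fm" where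
  "substs r (Atom p ts) = Atom p (map (tsubsts r) ts)"
| "substs r Bot = Bot"
| "substs r Top = Top"
| "substs r (Con a b) = Con (substs r a) (substs r b)"
| "substs r (And a b) = And (substs r a) (substs r b)"
| "substs r (Or a b) = Or (substs r a) (substs r b)"
| "substs r (Imp a b) = Imp (substs r a) (substs r b)"
| "substs r (Op c as) = Op c (map (substs r) as)"
| "substs r (Forall x a) = Forall x (substs (r(x := Var x)) a)"
| "substs r (Exists x a) = Exists x (substs (r(x := Var x)) a)"

fun qfree :: "('c, 'f, 'p) fm \<Rightarrow> bool" where
  "qfree (Atom p ts) = True"
| "qfree Bot = True"
| "qfree Top = True"
| "qfree (Con a b) = (qfree a \<and> qfree b)"
| "qfree (And a b) = (qfree a \<and> qfree b)"
| "qfree (Or a b) = (qfree a \<and> qfree b)"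
| "qfree (Imp a b) = (qfree a \<and> qfree b)"
| "qfree (Op c as) = (\<forall>a\<in>set as. qfree a)"
| "qfree (Forall x a) = False"
| "qfree (Exists x a) = False"

lemma tsubst_notin_fvt: "x \<notin> fvt t \<Longrightarrow> tsubst x s t = t"
  by (induction t) (auto intro: map_idI)

lemma tsubsts_Var: "tsubsts Var t = t"
  by (induction t) (auto intro: map_idI)

lemma tsubsts_cong: "(\<And>x. x \<in> fvt t \<Longrightarrow> r x = r' x) \<Longrightarrow> tsubsts r t = tsubsts r' t"
  by (induction t) auto

lemma tsubst_tsubsts: "tsubst x s (tsubsts r t) = tsubsts (\<lambda>y. tsubst x s (r y)) t"
  by (induction t) auto

lemma wf_tm_tsubsts: "wf_tm S t \<Longrightarrow> (\<And>x. wf_tm S (r x)) \<Longrightarrow> wf_tm S (tsubsts r t)"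
  by (induction t) auto

lemma substs_Var: "substs Var a = a"
  by (induction a) (auto simp: tsubsts_Var fun_upd_idem_iff intro: map_idI)

lemma finite_fvt: "finite (fvt t)"
  by (induction t) auto

lemma finite_fv: "finite (fv a)"
  by (induction a) (auto simp: finite_fvt)

lemma substs_cong: "(\<And>x. x \<in> fv a \<Longrightarrow> r x = r' x) \<Longrightarrow> substs r a = substs r' a"
proof (induction a arbitrary: r r')
  case (Atom p ts)
  then show ?case by (auto intro: tsubsts_cong)
next
  case (Con a b)
  from Con.IH(1)[of r r'] Con.IH(2)[of r r'] Con.prems show ?case by simp
next
  case (And a b)
  from And.IH(1)[of r r'] And.IH(2)[of r r'] And.prems show ?case by simp
next
  case (Or a b)
  from Or.IH(1)[of r r'] Or.IH(2)[of r r'] Or.prems show ?case by simp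
next
  case (Imp a b)
  from Imp.IH(1)[of r r'] Imp.IH(2)[of r r'] Imp.prems show ?case by simp
next
  case (Op c as)
  have "substs r a = substs r' a" if "a \<in> set as" for a
    by (rule Op.IH[OF that]) (use Op.prems that in auto)
  then show ?case by simp
next
  case (Forall x a)
  have "substs (r(x := Var x)) a = substs (r'(x := Var x)) a"
    by (rule Forall.IH) (use Forall.prems in auto)
  then show ?case by simp
next
  case (Exists x a)
  have "substs (r(x := Var x)) a = substs (r'(x := Var x)) a"
    by (rule Exists.IH) (use Exists.prems in auto)
  then show ?case by simp
qed auto

lemma subst_substs: "qfree a \<Longrightarrow> subst x s (substs r a) = substs (\<lambda>y. tsubst x s (r y)) a"
  by (induction a) (auto simp: tsubst_tsubsts)

lemma qfree_substs: "qfree a \<Longrightarrow> qfree (substs r a)"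
  by (induction a) auto

lemma wf_fm_substs: "qfree a \<Longrightarrow> wf_fm L S a \<Longrightarrow> (\<And>x. wf_tm S (r x)) \<Longrightarrow> wf_fm L S (substs r a)"
  by (induction a) (auto simp: wf_tm_tsubsts)

lemma qfree_substitutable: "qfree a \<Longrightarrow> substitutable t x a"
  by (induction a) auto

text \<open>For stripping a quantifier by instantiating it with its own variable: no free occurrence
  of \<open>x\<close> lies in the scope of a quantifier on \<open>x\<close>.\<close>

lemma substitutable_Var_self: "substitutable (Var x) x a"
  by (induction a) auto

lemma tsubst_Var_self: "tsubst x (Var x) t = t"
  by (induction t) (auto intro: map_idI)

lemma subst_Var_self: "subst x (Var x) a = a"
  by (induction a) (auto simp: tsubst_Var_self intro: map_idI)

section \<open>Instances of provable universal formulas\<close>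

lemma wf_fm_foralls: "wf_fm L S (foralls xs a) = wf_fm L S a"
  by (induction xs) auto

lemma prov_foralls_D:
  assumes "core_fuzzy_logic L" "wf_fm L S a" "prov L S \<Phi> (foralls xs a)"
  shows "prov L S \<Phi> a"
  using assms(3)
proof (induction xs)
  case (Cons x xs)
  have wf: "wf_fm L S (foralls xs a)" using assms(2) by (simp add: wf_fm_foralls)
  have "prov L S \<Phi> (Imp (Forall x (foralls xs a)) (foralls xs a))"
    using prov.Forall1[OF wf _ substitutable_Var_self[of x], of \<Phi>]
    by (simp add: subst_Var_self)
  then have "prov L S \<Phi> (foralls xs a)"
    by (rule prov_mp[OF assms(1) _ wf, rotated 2]) (use Cons wf in auto)
  then show ?case by (rule Cons.IH)
qed simp

text \<open>Free variables of a provable formula are implicitly universal: generalize over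
  \<open>x\<close>, then instantiate.\<close>

lemma prov_subst:
  assumes "core_fuzzy_logic L" "wf_fm L S a" "wf_fm L S (subst x t a)" "wf_tm S t"
    "substitutable t x a" "prov L S \<Phi> a"
  shows "prov L S \<Phi> (subst x t a)"
  using prov_mp[OF assms(1) _ assms(3) prov.Gen[OF assms(6)] prov.Forall1[OF assms(2,4,5)]] assms(2)
  by simp

text \<open>
  Variable 0 is substituted first. The terms substituted afterwards contain no other variable,
  so that the single substitutions do not interfere.
\<close>

lemma prov_substs:
  assumes L: "core_fuzzy_logic L" and wf: "wf_fm L S a" and qf: "qfree a" and p: "prov L S \<Phi> a"
    and r: "\<And>x. wf_tm S (r x)" "\<And>x. fvt (r x) \<subseteq> {0}"
  shows "prov L S \<Phi> (substs r a)"
proof -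
  \<comment> \<open>Stage \<open>n\<close>: exactly the variables below \<open>n\<close> have been
    replaced.\<close>
  define r' where "r' n = (\<lambda>x. if x < n then r x else Var x)" for n :: nat
  have r': "wf_tm S (r' n x)" for n x by (simp add: r'_def r(1))
  \<comment> \<open>If \<open>x < n\<close> then \<open>n\<close> is not 0, so it does not occur in
    \<open>r x\<close> and the term already inserted stays intact.\<close>
  have step: "tsubst n (r n) (r' n x) = r' (Suc n) x" for n x
  proof (cases "x < n")
    case True
    with r(2)[of x] have "n \<notin> fvt (r x)" by auto
    with True show ?thesis by (simp add: r'_def tsubst_notin_fvt)
  next
    case False
    then show ?thesis by (auto simp: r'_def less_Suc_eq)
  qed
  have "prov L S \<Phi> (substs (r' n) a)" for n
  proof (induction n)
    case 0
    then show ?case using p by (simp add: r'_def substs_Var)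
  next
    case (Suc n)
    have eq: "subst n (r n) (substs (r' n) a) = substs (r' (Suc n)) a"
      by (simp add: subst_substs[OF qf] step)
    show ?case
      using prov_subst[OF L _ _ r(1)[of n] _ Suc, of n] wf_fm_substs[OF qf wf r']
        qfree_substitutable[OF qfree_substs[OF qf]]
      by (simp add: eq)
  qed
  \<comment> \<open>Finitely many variables are free in \<open>a\<close>, so some stage agrees with
    \<open>r\<close> on all of them.\<close>
  moreover obtain n where "\<forall>x\<in>fv a. x < n"
    using finite_fv finite_nat_set_iff_bounded by blast
  then have "substs (r' n) a = substs r a"
    by (intro substs_cong) (simp add: r'_def)
  ultimately show ?thesis by metis
qed

section \<open>The term structure of provable atoms\<close>

text \<open>Provably similar terms stay distinct: a model must satisfy the similarity axioms, but
  may interpret \<open>sim\<close> by a relation other than identity.\<close>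

definition canon :: "'c logic \<Rightarrow> ('f, 'p) language \<Rightarrow> ('c, 'f, 'p) fm set \<Rightarrow>
    ('f tm, 'f, 'p, bool) struct" where
  "canon L S \<Phi> = \<lparr>dom = {t. wf_tm S t \<and> fvt t \<subseteq> {0}},
     pred_int = (\<lambda>p ts. prov L S \<Phi> (Atom p ts)), fun_int = Fn\<rparr>"

text \<open>
  Both conjunctions and nested heads are allowed, so that \<open>horn\<close> covers the matrices of Horn
  clauses and w-Horn clauses as well as those of the similarity axioms.
\<close>

fun pos :: "('c, 'f, 'p) fm \<Rightarrow> bool" where
  "pos (Con a b) = (pos a \<and> pos b)"
| "pos (And a b) = (pos a \<and> pos b)"
| "pos a = atomic a"

fun horn :: "('c, 'f, 'p) fm \<Rightarrow> bool" where
  "horn (Con a b) = (horn a \<and> horn b)"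
| "horn (And a b) = (horn a \<and> horn b)"
| "horn (Imp a b) = (pos a \<and> horn b)"
| "horn a = atomic a"

lemma qfree_pos: "pos a \<Longrightarrow> qfree a"
  by (induction a) (auto simp: atomic_def)

lemma qfree_horn: "horn a \<Longrightarrow> qfree a"
  by (induction a) (auto simp: atomic_def qfree_pos)

lemma wf_struct_canon: "wf_struct S (canon L S \<Phi>)"
proof -
  have "Var 0 \<in> dom (canon L S \<Phi>)" by (simp add: canon_def)
  moreover have "Fn f ts \<in> dom (canon L S \<Phi>)"
    if "f \<in> funs S" "set ts \<subseteq> dom (canon L S \<Phi>)" "length ts = fun_arity S f" for f ts
    using that by (auto simp: canon_def)
  moreover have "fun_int (canon L S \<Phi>) = Fn" by (simp add: canon_def)
  ultimately show ?thesis by (auto simp: wf_struct_def)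
qed

lemma tval_canon: "tval (canon L S \<Phi>) v t = tsubsts v t"
  by (induction t) (auto simp: canon_def)

lemma map_tval_canon: "map (tval (canon L S \<Phi>) v) ts = map (tsubsts v) ts"
  by (simp add: tval_canon)

lemma pred_int_canon: "pred_int (canon L S \<Phi>) p ts = prov L S \<Phi> (Atom p ts)"
  by (simp add: canon_def)

text \<open>Holds for atoms by construction and passes through both conjunctions, since provability
  distributes over them; consistency settles \<open>Bot\<close>.\<close>

lemma val_canon_pos:
  assumes "core_fuzzy_logic L" "consistent L S \<Phi>" "\<And>x. wf_tm S (v x)"
    and "pos a" "wf_fm L S a"
  shows "val (boolean_algebra2 I) (canon L S \<Phi>) v a \<longleftrightarrow> prov L S \<Phi> (substs v a)"
  using assms(4,5)
proof (induction a)
  case (Con a b)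
  then show ?case
    using assms(1,3) by (simp add: prov_Con_iff wf_fm_substs qfree_pos boolean_algebra2_def)
next
  case (And a b)
  then show ?case
    using assms(1,3) by (simp add: prov_And_iff wf_fm_substs qfree_pos boolean_algebra2_def)
next
  case (Atom p ts)
  then show ?case by (simp add: map_tval_canon pred_int_canon)
next
  case Bot
  then show ?case using assms(2) by (simp add: boolean_algebra2_def consistent_def)
next
  case Top
  then show ?case using prov_Top[OF assms(1)] by (simp add: boolean_algebra2_def)
qed (auto simp: atomic_def)

text \<open>A true antecedent is provable by \<open>val_canon_pos\<close>, so detachment yields the
  head. The converse may fail: an implication with unprovable antecedent is true here without having
  to be provable.\<close>

lemma val_canon_horn:
  assumes "core_fuzzy_logic L" "consistent L S \<Phi>" "\<And>x. wf_tm S (v x)"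
    and "horn a" "wf_fm L S a" "prov L S \<Phi> (substs v a)"
  shows "val (boolean_algebra2 I) (canon L S \<Phi>) v a"
  using assms(4-6)
proof (induction a)
  case (Con a b)
  then show ?case
    using assms(1,3) by (simp add: prov_Con_iff wf_fm_substs qfree_horn boolean_algebra2_def)
next
  case (And a b)
  then show ?case
    using assms(1,3) by (simp add: prov_And_iff wf_fm_substs qfree_horn boolean_algebra2_def)
next
  case (Imp a b)
  have "prov L S \<Phi> (substs v b)" if "prov L S \<Phi> (substs v a)"
    by (rule prov_mp[OF assms(1) _ _ that])
      (use Imp assms(3) in \<open>auto simp: wf_fm_substs qfree_horn qfree_pos\<close>)
  then show ?case
    using val_canon_pos[OF assms(1,2), of v a] assms(3) Imp by (auto simp: boolean_algebra2_def)
next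
  case (Atom p ts)
  then show ?case using val_canon_pos[where v = v, OF assms(1-3), of "Atom p ts"] by simp
next
  case Bot
  then show ?case using val_canon_pos[where v = v, OF assms(1-3), of Bot] by simp
next
  case Top
  then show ?case using val_canon_pos[where v = v, OF assms(1-3), of Top] by simp
qed (auto simp: atomic_def)

lemma infimum_boolean_algebra2: "infimum (boolean_algebra2 I) X = (\<forall>x\<in>X. x)"
  unfolding infimum_def by (rule the_equality) (auto simp: leq_def boolean_algebra2_def)

lemma val_foralls:
  assumes "\<And>v. range v \<subseteq> dom M \<Longrightarrow> val (boolean_algebra2 I) M v a" "range v \<subseteq> dom M"
  shows "val (boolean_algebra2 I) M v (foralls xs a)"
  using assms(2)
proof (induction xs arbitrary: v)
  case (Cons x xs)
  have "range (v(x := m)) \<subseteq> dom M" if "m \<in> dom M" for m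
    using Cons.prems that by auto
  with Cons.IH show ?case by (simp add: infimum_boolean_algebra2)
qed (use assms(1) in simp)

text \<open>Each evaluation in the domain is a substitution of the kind \<open>prov_substs\<close>
  admits, so all relevant instances of the matrix are provable, hence true.\<close>

lemma val_canon_foralls_horn:
  fixes \<Phi> :: "('c, 'f, 'p) fm set"
  assumes "core_fuzzy_logic L" "consistent L S \<Phi>" "horn a" "wf_fm L S a"
    and "prov L S \<Phi> (foralls xs a)" "range v \<subseteq> dom (canon L S \<Phi>)"
  shows "val (boolean_algebra2 I) (canon L S \<Phi>) v (foralls xs a)"
  using _ assms(6)
proof (rule val_foralls)
  fix v :: "nat \<Rightarrow> 'f tm" assume "range v \<subseteq> dom (canon L S \<Phi>)"
  then have v: "wf_tm S (v x)" "fvt (v x) \<subseteq> {0}" for x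
    by (auto simp: canon_def)
  show "val (boolean_algebra2 I) (canon L S \<Phi>) v a"
    using assms prov_foralls_D[OF assms(1,4,5)] v
    by (intro val_canon_horn prov_substs) (auto simp: qfree_horn)
qed

section \<open>The similarity axioms and Horn clauses\<close>

lemma pos_sconj: "(\<And>a. a \<in> set as \<Longrightarrow> pos a) \<Longrightarrow> pos (sconj as)"
  by (induction as rule: sconj.induct) (auto simp: atomic_def)

lemma horn_imp_from: "(\<And>a. a \<in> set as \<Longrightarrow> pos a) \<Longrightarrow> horn b \<Longrightarrow> horn (imp_from as b)"
  by (cases as) (auto intro: pos_sconj)

lemma wf_fm_sconj: "(\<And>a. a \<in> set as \<Longrightarrow> wf_fm L S a) \<Longrightarrow> wf_fm L S (sconj as)"
  by (induction as rule: sconj.induct) auto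

lemma wf_fm_imp_from:
  "(\<And>a. a \<in> set as \<Longrightarrow> wf_fm L S a) \<Longrightarrow> wf_fm L S b \<Longrightarrow> wf_fm L S (imp_from as b)"
  by (cases as) (auto intro: wf_fm_sconj)

text \<open>Lets the similarity axioms be verified in the same way as the given clauses. Congruence
  for predicates has an equivalence as its head, which \<open>horn\<close> admits.\<close>

lemma sim_axms_horn:
  assumes S: "wf_language S" and a: "a \<in> sim_axms S"
  shows "\<exists>xs b. a = foralls xs b \<and> horn b \<and> wf_fm L S b"
proof -
  have atom: "pos (sim_atom S s t)" "horn (sim_atom S s t)"
    "wf_tm S s \<Longrightarrow> wf_tm S t \<Longrightarrow> wf_fm L S (sim_atom S s t)" for s t
    using S by (auto simp: sim_atom_def wf_language_def atomic_def)
  \<comment> \<open>Function and predicate congruence differ only in the head \<open>concl\<close>;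
    the length conditions supply the correct arities.\<close>
  have congr: ?thesis
    if "a = congruence_axm S n concl"
      and "\<And>xs ys. length xs = n \<Longrightarrow> length ys = n \<Longrightarrow> \<forall>t\<in>set xs \<union> set ys. wf_tm S t \<Longrightarrow>
        horn (concl xs ys) \<and> wf_fm L S (concl xs ys)"
    for n concl
  proof -
    have concl: "horn (concl (map Var [0..<n]) (map Var [n..<2 * n])) \<and>
        wf_fm L S (concl (map Var [0..<n]) (map Var [n..<2 * n]))"
      by (rule that(2)) auto
    show ?thesis
      unfolding that(1) congruence_axm_def
      by (intro exI conjI, rule refl)
        (use concl in \<open>auto simp: atom intro!: horn_imp_from wf_fm_imp_from\<close>)
  qed
  from a consider
      "a = foralls [0] (sim_atom S (Var 0) (Var 0))"
    | "a = foralls [0, 1] (Imp (sim_atom S (Var 0) (Var 1)) (sim_atom S (Var 1) (Var 0)))"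
    | "a = foralls [0, 1, 2]
        (Imp (Con (sim_atom S (Var 0) (Var 1)) (sim_atom S (Var 1) (Var 2)))
          (sim_atom S (Var 0) (Var 2)))"
    | f where "f \<in> funs S"
        "a = congruence_axm S (fun_arity S f) (\<lambda>xs ys. sim_atom S (Fn f xs) (Fn f ys))"
    | p where "p \<in> preds S"
        "a = congruence_axm S (pred_arity S p) (\<lambda>xs ys. Iff (Atom p xs) (Atom p ys))"
    unfolding sim_axms_def by blast
  then show ?thesis
  proof cases
    case 1
    then show ?thesis by (intro exI conjI) (assumption, auto simp: atom)
  next
    case 2
    then show ?thesis by (intro exI conjI) (assumption, auto simp: atom)
  next
    case 3
    then show ?thesis by (intro exI conjI) (assumption, auto simp: atom)
  next
    case 4
    then show ?thesis by (intro congr[OF 4(2)]) (auto simp: atom)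
  next
    case 5
    then show ?thesis by (intro congr[OF 5(2)]) (auto simp: atomic_def)
  qed
qed

lemma pos_conj_of:
  assumes "cj = Con \<or> cj = And" "conj_of cj atomic a"
  shows "pos a"
  using assms(2) by induction (use assms(1) in \<open>auto simp: atomic_def\<close>)

lemma horn_conj_of_basic_horn:
  assumes cj: "cj = Con \<or> cj = And" and "conj_of cj (basic_horn cj) a"
  shows "horn a"
  using assms(2)
proof induction
  case (Base a)
  then show ?case using pos_conj_of[OF cj] by (auto simp: basic_horn_def atomic_def)
next
  case (Step a b)
  then show ?case using cj by auto
qed

text \<open>Similarity axioms and members of \<open>\<Phi>\<close> alike are provable universal
  closures of \<open>horn\<close> matrices, so they are true in the term structure.\<close>

lemma classical_model_canon:
  assumes L: "core_fuzzy_logic L" and S: "wf_language S" and con: "consistent L S \<Phi>"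
    and wf: "\<And>a. a \<in> \<Phi> \<Longrightarrow> wf_fm L S a"
    and cj: "cj = Con \<or> cj = And" and horn: "\<And>a. a \<in> \<Phi> \<Longrightarrow> horn_clause_with cj a"
  shows "classical_model S (canon L S \<Phi>) \<Phi>"
proof -
  have "\<exists>xs b. a = foralls xs b \<and> horn b \<and> wf_fm L S b \<and> prov L S \<Phi> a"
    if "a \<in> sim_axms S \<union> \<Phi>" for a
  proof (cases "a \<in> sim_axms S")
    case True
    then show ?thesis using sim_axms_horn[OF S] prov.Sim by blast
  next
    case False
    with that have a: "a \<in> \<Phi>" by simp
    from horn[OF a] obtain xs b where "a = foralls xs b" "horn b"
      using horn_conj_of_basic_horn[OF cj] by (auto simp: horn_clause_with_def)
    then show ?thesis using wf[OF a] prov.Hyp[OF a wf[OF a]] by (auto simp: wf_fm_foralls)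
  qed
  \<comment> \<open>The interpretation \<open>I\<close> is arbitrary, because \<open>horn\<close>
    formulas contain no additional connectives.\<close>
  then have "val (boolean_algebra2 I) (canon L S \<Phi>) v a"
    if "a \<in> sim_axms S \<union> \<Phi>" "range v \<subseteq> dom (canon L S \<Phi>)" for I v a
    using that val_canon_foralls_horn[OF L con] by metis
  then show ?thesis
    by (auto simp: classical_model_def model_def wf_struct_canon boolean_algebra2_def)
qed

theorem corollary1:
  fixes L :: "'c logic" and S :: "('f, 'p) language" and \<Phi> :: "('c, 'f, 'p) fm set"
  assumes "core_fuzzy_logic L"
    and "only_standard_truth_constants L"
    and "wf_language S"
    and "\<forall>a\<in>\<Phi>. wf_fm L S a \<and> fv a = {}"
    and "consistent L S \<Phi>"
  shows "((\<forall>a\<in>\<Phi>. horn_clause a) \<longrightarrow>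
            (\<exists>M :: ('f tm, 'f, 'p, bool) struct. classical_model S M \<Phi>)) \<and>
         ((\<forall>a\<in>\<Phi>. w_horn_clause a) \<longrightarrow>
            (\<exists>M :: ('f tm, 'f, 'p, bool) struct. classical_model S M \<Phi>))"
  using assms classical_model_canon[OF assms(1,3,5), of Con]
    classical_model_canon[OF assms(1,3,5), of And]
  unfolding horn_clause_def w_horn_clause_def by metis

end
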